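(* Let $p\in[1,\infty]$ and let $X$ be a non-empty set whose elements are finite subsets of some universe. Define $d_N^p:X\times X\to\mathbb{R}$ by $$d_N^p(A,B)=\frac{\big(|A\setminus B|^p+|B\setminus A|^p\big)^{1/p}}{|A\cup B|}\quad\text{if } |A\cup B|\neq 0,\qquad d_N^p(A,B)=0\ \text{ otherwise}$$ (for $p=\infty$ the numerator is $\max(|A\setminus B|,|B\setminus A|)$). Then $(X,d_N^p)$ is a metric space. In addition, $d_N^p$ takes values in $[0,1]$.
   Context: $|\cdot|$ denotes the cardinality of a finite set and $A\setminus B=A\cap B^c$. A metric $d$ on $X$ is a real-valued function that is nonnegative, symmetric, satisfies $d(a,b)=0\iff a=b$, and satisfies the triangle inequality. *)

theory Defs
  imports "HOL-Analysis.Abstract_Metric_Spaces" "HOL-Library.Extended_Real"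
begin

text \<open>
  The \<open>\<ell>\<^sup>p\<close> norm of the pair \<open>(x, y)\<close>, with the exponent ranging over the extended reals so that
  \<open>p = \<infinity>\<close> is included. It is meant for \<open>1 \<le> p\<close> and \<open>x, y \<ge> 0\<close>; since \<open>0 powr r = 0\<close>,
  the usual convention \<open>0\<^sup>p = 0\<close> holds.
\<close>

definition lp_norm2 :: "ereal \<Rightarrow> real \<Rightarrow> real \<Rightarrow> real" where
  "lp_norm2 p x y =
     (if p = \<infinity> then max x y
      else (x powr real_of_ereal p + y powr real_of_ereal p) powr (1 / real_of_ereal p))"

definition dN :: "ereal \<Rightarrow> 'a set \<Rightarrow> 'a set \<Rightarrow> real" where
  "dN p A B =
     (if card (A \<union> B) \<noteq> 0
      then lp_norm2 p (real (card (A - B))) (real (card (B - A))) / real (card (A \<union> B))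
      else 0)"

end

theory Submission
  imports Defs
begin

text \<open>
  Only four properties of \<open>N = lp_norm2 p\<close> on the nonnegative quadrant matter: monotonicity,
  homogeneity, subadditivity, and \<open>N x 0 = N 0 x = x\<close>. For the triangle inequality put
  \<open>u = |A \<union> C|\<close> and \<open>s = |B - (A \<union> C)|\<close>. Enlarging both denominators on the right to
  \<open>|A \<union> B \<union> C| = u + s\<close>, subadditivity bounds the right-hand side below by
  \<open>N (|A - C| + s) (|C - A| + s) / (u + s)\<close>. Since \<open>|A - C|\<close> and \<open>|C - A|\<close> are at most \<open>u\<close>, the vector
  in the numerator dominates \<open>(1 + s / u) (|A - C|, |C - A|)\<close>, and homogeneity gives the left-hand side.
\<close>

lemma ereal_ge_1_cases:
  assumes "1 \<le> (p::ereal)"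
  obtains (PInf) "p = \<infinity>" | (real) r where "p = ereal r" "1 \<le> r"
  using assms by (cases p) (auto simp: one_ereal_def)

lemma lp_norm2_commute: "lp_norm2 p x y = lp_norm2 p y x"
  by (simp add: lp_norm2_def max.commute add.commute)

lemma lp_norm2_mono:
  assumes "1 \<le> p" "0 \<le> x" "0 \<le> y" "x \<le> x'" "y \<le> y'"
  shows "lp_norm2 p x y \<le> lp_norm2 p x' y'"
  using assms(1)
proof (cases rule: ereal_ge_1_cases)
  case PInf
  then show ?thesis using assms by (auto simp: lp_norm2_def)
next
  case (real r)
  then show ?thesis using assms
    by (auto simp: lp_norm2_def intro!: powr_mono2 add_mono)
qed

lemma lp_norm2_0_right:
  assumes "1 \<le> p" "0 \<le> x"
  shows "lp_norm2 p x 0 = x"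
  using assms(1)
proof (cases rule: ereal_ge_1_cases)
  case PInf
  then show ?thesis using assms by (auto simp: lp_norm2_def)
next
  case (real r)
  then show ?thesis using assms by (simp add: lp_norm2_def powr_powr)
qed

lemma lp_norm2_0_left:
  assumes "1 \<le> p" "0 \<le> x"
  shows "lp_norm2 p 0 x = x"
  using lp_norm2_0_right[OF assms] lp_norm2_commute[of p 0 x] by simp

text \<open>Compare \<open>(x, y)\<close> with \<open>(x, 0)\<close> and \<open>(0, y)\<close>. This
  bound later gives both nonnegativity and definiteness of \<open>dN\<close>.\<close>

lemma lp_norm2_ge:
  assumes "1 \<le> p" "0 \<le> x" "0 \<le> y"
  shows "x \<le> lp_norm2 p x y" "y \<le> lp_norm2 p x y"
  using lp_norm2_mono[of p x 0 x y] lp_norm2_mono[of p 0 y x y]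
    lp_norm2_0_right[of p x] lp_norm2_0_left[of p y] assms by auto

lemma lp_norm2_mult:
  assumes "1 \<le> p" "0 \<le> c" "0 \<le> x" "0 \<le> y"
  shows "lp_norm2 p (c * x) (c * y) = c * lp_norm2 p x y"
  using assms(1)
proof (cases rule: ereal_ge_1_cases)
  case PInf
  then show ?thesis using assms by (auto simp: lp_norm2_def max_mult_distrib_left)
next
  case (real r)
  have "(c * x) powr r + (c * y) powr r = c powr r * (x powr r + y powr r)"
    using assms by (simp add: powr_mult distrib_left)
  then show ?thesis using assms real
    by (simp add: lp_norm2_def powr_mult powr_powr)
qed

lemma lp_norm2_powr:
  assumes "1 \<le> r" "0 \<le> x" "0 \<le> y"
  shows "lp_norm2 (ereal r) x y powr r = x powr r + y powr r"
  using assms by (simp add: lp_norm2_def powr_powr)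

text \<open>For positive \<open>s\<close> and \<open>t\<close> this is \<open>powr_convex\<close>.
  If one of them is 0, a single term remains on each side, and \<open>k powr r \<le> k\<close> for
  \<open>k\<close> in [0, 1] suffices.\<close>

lemma powr_convex_nonneg:
  fixes s t l r :: real
  assumes "1 \<le> r" "0 \<le> s" "0 \<le> t" "0 \<le> l" "l \<le> 1"
  shows "((1 - l) * s + l * t) powr r \<le> (1 - l) * s powr r + l * t powr r"
proof -
  have scale: "(k * v) powr r \<le> k * v powr r" if "0 \<le> k" "k \<le> 1" "0 \<le> v" for k v :: real
  proof -
    have "k powr r \<le> k"
      using powr_mono'[of 1 r k] that assms(1) by simp
    then show ?thesis using that by (simp add: powr_mult mult_right_mono)
  qed
  consider "s = 0" | "t = 0" | "s > 0" "t > 0" using assms by linarith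
  then show ?thesis
  proof cases
    case 3
    then show ?thesis
      using convex_onD[OF powr_convex[OF assms(1)], of l s t] assms by simp
  qed (use scale[of l t] scale[of "1 - l" s] assms in auto)
qed

text \<open>
  Minkowski's inequality: \<open>(x + x', y + y') / (N x y + N x' y')\<close> is a convex combination of
  two unit vectors, and the unit ball is convex because \<open>t \<mapsto> t\<^sup>p\<close> is.
\<close>

lemma lp_norm2_triangle:
  assumes p: "1 \<le> p" and nn: "0 \<le> x" "0 \<le> y" "0 \<le> x'" "0 \<le> y'"
  shows "lp_norm2 p (x + x') (y + y') \<le> lp_norm2 p x y + lp_norm2 p x' y'"
  using assms(1)
proof (cases rule: ereal_ge_1_cases)
  case PInf
  then show ?thesis using assms by (auto simp: lp_norm2_def)
next
  case (real r)
  define F G where "F = lp_norm2 p x y" and "G = lp_norm2 p x' y'"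
  have Fge: "x \<le> F" "y \<le> F" and Gge: "x' \<le> G" "y' \<le> G"
    unfolding F_def G_def using lp_norm2_ge p nn by auto
  \<comment> \<open>Normalising divides by \<open>F\<close> and \<open>G\<close>. If one of them
    vanishes, its vector is zero by \<open>Fge\<close> or \<open>Gge\<close>.\<close>
  consider "F = 0" | "G = 0" | "F > 0" "G > 0" using Fge Gge nn by linarith
  then show ?thesis
  proof cases
    case 1
    then show ?thesis using Fge nn by (simp add: F_def)
  next
    case 2
    then show ?thesis using Gge nn by (simp add: G_def)
  next
    case 3
    \<comment> \<open>Weights in the proportion F : G undo the normalisation: the combination of the
      two unit vectors is the sum vector divided by \<open>F + G\<close>.\<close>
    define l where "l = G / (F + G)"
    have l: "0 \<le> l" "l \<le> 1" "1 - l = F / (F + G)" "F + G > 0"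
      using 3 by (auto simp: l_def field_simps)
    have cvx: "((1 - l) * s + l * t) powr r \<le> (1 - l) * s powr r + l * t powr r"
      if "0 \<le> s" "0 \<le> t" for s t
      using powr_convex_nonneg real(2) that l by blast
    have comb: "a + b = (F + G) * ((1 - l) * (a / F) + l * (b / G))" for a b
      unfolding l(3) using 3 l(4) by (simp add: l_def distrib_left)
    have unit: "(x / F) powr r + (y / F) powr r = 1" "(x' / G) powr r + (y' / G) powr r = 1"
      using lp_norm2_powr[of r x y] lp_norm2_powr[of r x' y'] nn 3 real
      by (auto simp: F_def G_def powr_divide simp flip: add_divide_distrib)
    define a b where "a = (1 - l) * (x / F) + l * (x' / G)"
      and "b = (1 - l) * (y / F) + l * (y' / G)"
    have ab: "0 \<le> a" "0 \<le> b" using nn 3 l by (auto simp: a_def b_def)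
    have "a powr r + b powr r \<le> (1 - l) * ((x / F) powr r + (y / F) powr r)
        + l * ((x' / G) powr r + (y' / G) powr r)"
      using cvx[of "x / F" "x' / G"] cvx[of "y / F" "y' / G"] nn 3
      by (simp add: a_def b_def algebra_simps)
    also have "\<dots> = 1" by (simp add: unit)
    finally have "lp_norm2 p a b \<le> 1"
      using real by (auto simp: lp_norm2_def intro!: powr_le1 simp: divide_le_eq)
    then have "lp_norm2 p (x + x') (y + y') \<le> F + G"
      using lp_norm2_mult[OF p _ ab, of "F + G"] l(4) comb[of x x'] comb[of y y']
      by (simp add: a_def b_def)
    then show ?thesis by (simp add: F_def G_def)
  qed
qed

text \<open>The case distinction in the definition is redundant since \<open>x / 0 = 0\<close>.\<close>

lemma dN_eq: "dN p A B = lp_norm2 p (card (A - B)) (card (B - A)) / card (A \<union> B)"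
  by (simp add: dN_def)

lemma dN_nonneg:
  assumes "1 \<le> p"
  shows "0 \<le> dN p A B"
  using lp_norm2_ge(1)[OF assms, of "card (A - B)" "card (B - A)"]
  by (auto simp: dN_def)

lemma dN_commute: "dN p A B = dN p B A"
  by (simp add: dN_def lp_norm2_commute Un_commute)

text \<open>Splitting the pair into \<open>(a, 0) + (0, b)\<close> bounds the norm by
  \<open>a + b\<close>, the size of the symmetric difference, which lies in the union.\<close>

lemma dN_le_1:
  assumes "1 \<le> p" "finite A" "finite B"
  shows "dN p A B \<le> 1"
proof -
  have "lp_norm2 p (card (A - B)) (card (B - A)) \<le> real (card (A - B)) + card (B - A)"
    using lp_norm2_triangle[OF assms(1), of "card (A - B)" 0 0 "card (B - A)"]
    by (simp add: lp_norm2_0_left lp_norm2_0_right assms)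
  also have "\<dots> = card ((A - B) \<union> (B - A))"
    using assms by (subst card_Un_disjoint) auto
  also have "\<dots> \<le> card (A \<union> B)"
    using assms by (intro of_nat_mono card_mono) auto
  finally show ?thesis by (auto simp: dN_def divide_le_eq)
qed

lemma dN_eq_0_iff:
  assumes "1 \<le> p" "finite A" "finite B"
  shows "dN p A B = 0 \<longleftrightarrow> A = B"
proof
  assume "dN p A B = 0"
  then have "A \<union> B = {} \<or> lp_norm2 p (card (A - B)) (card (B - A)) = 0"
    using assms by (auto simp: dN_eq)
  then show "A = B"
  proof
    assume "lp_norm2 p (card (A - B)) (card (B - A)) = 0"
    then have "card (A - B) = 0" "card (B - A) = 0"
      using lp_norm2_ge[OF assms(1), of "card (A - B)" "card (B - A)"] by auto
    then show "A = B" using assms by auto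
  qed auto
next
  assume "A = B"
  then show "dN p A B = 0" using assms by (simp add: dN_def lp_norm2_0_left)
qed

text \<open>Serves to put two distances over one common denominator.\<close>

lemma dN_ge:
  assumes "1 \<le> p" "finite A" "finite B" "card (A \<union> B) \<le> m"
  shows "lp_norm2 p (card (A - B)) (card (B - A)) / m \<le> dN p A B"
proof (cases "A \<union> B = {}")
  case True
  then show ?thesis using assms by (simp add: dN_def lp_norm2_0_left)
next
  case False
  then have "0 < card (A \<union> B)" using assms by (simp add: card_gt_0_iff)
  moreover have "0 \<le> lp_norm2 p (card (A - B)) (card (B - A))"
    using lp_norm2_ge(1)[OF assms(1), of "card (A - B)" "card (B - A)"] by simp
  ultimately show ?thesis
    using assms by (simp add: dN_eq) (intro divide_left_mono; simp)
qed

text \<open>A point of \<open>A - C\<close> lies in \<open>B - C\<close> or in \<open>A - B\<close>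
  according to whether it is in \<open>B\<close>; a point of \<open>B\<close> outside
  \<open>A \<union> C\<close> lies in \<open>B - C\<close>. The extra second term on the left is
  what pays for the enlarged denominators.\<close>

lemma card_Diff_triangle:
  assumes "finite A" "finite B" "finite C"
  shows "card (A - C) + card (B - (A \<union> C)) \<le> card (A - B) + card (B - C)"
proof -
  have "card (A - C) + card (B - (A \<union> C)) = card ((A - C) \<union> (B - (A \<union> C)))"
    using assms by (subst card_Un_disjoint) auto
  also have "\<dots> \<le> card ((A - B) \<union> (B - C))"
    using assms by (intro card_mono) auto
  also have "\<dots> \<le> card (A - B) + card (B - C)"
    by (rule card_Un_le)
  finally show ?thesis .
qed

lemma dN_triangle:
  assumes p: "1 \<le> p" and fin: "finite A" "finite B" "finite C"
  shows "dN p A C \<le> dN p A B + dN p B C"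
proof (cases "A \<union> C = {}")
  case True
  then have "dN p A C = 0" by (simp add: dN_def)
  then show ?thesis using dN_nonneg[OF p, of A B] dN_nonneg[OF p, of B C] by simp
next
  case False
  define s u where "s = card (B - (A \<union> C))" and "u = card (A \<union> C)"
  let ?a = "real (card (A - C))" and ?b = "real (card (C - A))"
  have u: "0 < u" using False fin by (simp add: u_def card_gt_0_iff)
  have "card (A - C) \<le> u" "card (C - A) \<le> u"
    unfolding u_def using fin by (auto intro!: card_mono)
  then have le: "(1 + s / u) * ?a \<le> ?a + s" "(1 + s / u) * ?b \<le> ?b + s"
    using u by (simp_all add: field_simps flip: of_nat_mult of_nat_add)
  have "card (A \<union> B \<union> C) = u + s"
    unfolding u_def s_def using fin
    by (subst card_Un_disjoint[symmetric]) (auto intro: arg_cong[where f = card])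
  then have us: "card (A \<union> B) \<le> u + s" "card (B \<union> C) \<le> u + s"
    using card_mono[of "A \<union> B \<union> C" "A \<union> B"] card_mono[of "A \<union> B \<union> C" "B \<union> C"] fin by auto
  have "dN p A C = (1 + s / u) * lp_norm2 p ?a ?b / (u + s)"
  proof -
    have "(1 + s / u) * L / (u + s) = L / u" for L :: real
    proof -
      have "(1 + s / u) / (u + s) = 1 / real u"
        using u by (simp add: divide_simps add.commute)
      then show ?thesis
        by (metis mult.commute mult_1 times_divide_eq_left)
    qed
    then show ?thesis by (simp add: dN_eq u_def)
  qed
  also have "\<dots> = lp_norm2 p ((1 + s / u) * ?a) ((1 + s / u) * ?b) / (u + s)"
    by (subst lp_norm2_mult[OF p]) auto
  \<comment> \<open>The second coordinate is the first with \<open>A\<close> and \<open>C\<close>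
    exchanged, which leaves \<open>s\<close> unchanged.\<close>
  also have "\<dots> \<le> lp_norm2 p (card (A - B) + card (B - C)) (card (B - A) + card (C - B)) / (u + s)"
    using le card_Diff_triangle[of A B C] card_Diff_triangle[of C B A] fin
    by (intro divide_right_mono lp_norm2_mono p) (auto simp: s_def Un_commute)
  also have "\<dots> \<le> (lp_norm2 p (card (A - B)) (card (B - A))
      + lp_norm2 p (card (B - C)) (card (C - B))) / (u + s)"
    unfolding of_nat_add by (intro divide_right_mono lp_norm2_triangle p) auto
  also have "\<dots> \<le> dN p A B + dN p B C"
    using dN_ge[OF p _ _ us(1)] dN_ge[OF p _ _ us(2)] fin
    by (simp add: add_divide_distrib)
  finally show ?thesis .
qed

theorem theorem3p2:
  fixes p :: ereal and X :: "'a set set"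
  assumes "1 \<le> p"
    and "X \<noteq> {}"
    and "\<And>A. A \<in> X \<Longrightarrow> finite A"
  shows "Metric_space X (dN p) \<and> (\<forall>A\<in>X. \<forall>B\<in>X. dN p A B \<in> {0..1})"
proof
  show "Metric_space X (dN p)"
    using assms by unfold_locales
      (simp_all add: dN_nonneg dN_eq_0_iff dN_triangle dN_commute)
  show "\<forall>A\<in>X. \<forall>B\<in>X. dN p A B \<in> {0..1}"
    using assms by (simp add: dN_nonneg dN_le_1)
qed

end
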